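(* Let $G$ be a profinite group, let $F$ be a $G$-equivariant sheaf of sets over a profinite $G$-space $X$, and let $U$ be an open subset of $X$. Any section of $F(U)$ restricts to an $N$-equivariant section over an $N$-invariant domain, for some open normal subgroup $N$ of $G$.
   Context: A profinite space is a compact, Hausdorff, totally disconnected space; a profinite group is a topological group whose underlying space is profinite. A $G$-space is a topological space with a continuous left $G$-action; a profinite $G$-space is a $G$-space whose underlying space is profinite. A $G$-equivariant sheaf of sets over $X$ is a $G$-equivariant local homeomorphism $p\colon E\to X$ with $E$ a $G$-space. $F(U)=\Gamma(U,E)$ is the set of all continuous (not necessarily equivariant) sections $s\colon U\to E$ of $p$. The domain of a section is the open subset of $X$ over which it is defined, and a section over $U$ restricts to a section over any open subset of $U$. An open subset $V$ of $X$ is $N$-invariant if $nV=V$ for all $n\in N$; a section $s$ over an $N$-invariant open set $V$ is $N$-equivariant if $n\ast s:=n\circ s\circ n^{-1}=s$ for all $n\in N$, i.e. $s(nv)=ns(v)$ for all $n\in N$, $v\in V$. *)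

theory Defs
  imports "HOL-Analysis.Abstract_Topological_Spaces" "HOL-Algebra.Group_Action"
begin

definition totally_disconnected_space :: "'a topology \<Rightarrow> bool" where
  "totally_disconnected_space X \<longleftrightarrow> (\<forall>S. connectedin X S \<longrightarrow> (\<exists>a. S \<subseteq> {a}))"

definition profinite_space :: "'a topology \<Rightarrow> bool" where
  "profinite_space X \<longleftrightarrow>
     compact_space X \<and> Hausdorff_space X \<and> totally_disconnected_space X"

locale topological_group = group G for G (structure) +
  fixes T :: "'a topology"
  assumes topspace_eq_carrier: "topspace T = carrier G"
    and continuous_mult: "continuous_map (prod_topology T T) T (\<lambda>(g, h). g \<otimes> h)"
    and continuous_inv: "continuous_map T T (\<lambda>g. inv g)"

locale profinite_group = topological_group +
  assumes profinite: "profinite_space T"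

(* Following the library's group actions, each \<phi> g is an extensional function on
   topspace X, i.e. it is undefined outside topspace X. *)
locale G_space = topological_group G T + group_action G "topspace X" \<phi>
  for G (structure) and T and X :: "'x topology" and \<phi> +
  assumes continuous_action: "continuous_map (prod_topology T X) X (\<lambda>(g, x). \<phi> g x)"

locale profinite_G_space = G_space +
  assumes profinite: "profinite_space X"

definition local_homeomorphism :: "'e topology \<Rightarrow> 'x topology \<Rightarrow> ('e \<Rightarrow> 'x) \<Rightarrow> bool" where
  "local_homeomorphism E X p \<longleftrightarrow>
     (\<forall>e \<in> topspace E. \<exists>W. openin E W \<and> e \<in> W \<and> openin X (p ` W) \<and>
        homeomorphic_map (subtopology E W) (subtopology X (p ` W)) p)"

locale equivariant_sheaf =
  base: G_space G T X \<phi> + total: G_space G T E \<psi>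
  for G (structure) and T and X :: "'x topology" and \<phi> and E :: "'e topology" and \<psi> +
  fixes p :: "'e \<Rightarrow> 'x"
  assumes local_homeo: "local_homeomorphism E X p"
    and equivariant: "\<lbrakk>g \<in> carrier G; e \<in> topspace E\<rbrakk> \<Longrightarrow> p (\<psi> g e) = \<phi> g (p e)"

(* Sections are taken extensional, so that equality of sections over U is equality of
   functions and restriction to V is the function "restrict s V". *)
definition sections ::
    "'e topology \<Rightarrow> 'x topology \<Rightarrow> ('e \<Rightarrow> 'x) \<Rightarrow> 'x set \<Rightarrow> ('x \<Rightarrow> 'e) set" where
  "sections E X p U =
     {s \<in> extensional U. continuous_map (subtopology X U) E s \<and> (\<forall>x\<in>U. p (s x) = x)}"

(* For a section s over V, the section g * s = g o s o g^{-1} over gV. *)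
definition translate_section ::
    "('g, 'm) monoid_scheme \<Rightarrow> ('g \<Rightarrow> 'x \<Rightarrow> 'x) \<Rightarrow> ('g \<Rightarrow> 'e \<Rightarrow> 'e) \<Rightarrow>
       'g \<Rightarrow> 'x set \<Rightarrow> ('x \<Rightarrow> 'e) \<Rightarrow> 'x \<Rightarrow> 'e" where
  "translate_section G \<phi> \<psi> g V s =
     restrict (\<lambda>y. \<psi> g (s (\<phi> (inv\<^bsub>G\<^esub> g) y))) (\<phi> g ` V)"

definition invariant_set :: "('g \<Rightarrow> 'x \<Rightarrow> 'x) \<Rightarrow> 'g set \<Rightarrow> 'x set \<Rightarrow> bool" where
  "invariant_set \<phi> N V \<longleftrightarrow> (\<forall>n\<in>N. \<phi> n ` V = V)"

definition equivariant_section ::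
    "('g, 'm) monoid_scheme \<Rightarrow> ('g \<Rightarrow> 'x \<Rightarrow> 'x) \<Rightarrow> ('g \<Rightarrow> 'e \<Rightarrow> 'e) \<Rightarrow>
       'g set \<Rightarrow> 'x set \<Rightarrow> ('x \<Rightarrow> 'e) \<Rightarrow> bool" where
  "equivariant_section G \<phi> \<psi> N V s \<longleftrightarrow> (\<forall>n\<in>N. translate_section G \<phi> \<psi> n V s = s)"

end

theory Submission
  imports Defs
begin

text \<open>
  Near \<open>(1, x)\<close> the points \<open>g s(y)\<close> and \<open>s(g y)\<close> both lie in a
  neighbourhood of \<open>s(x)\<close> on which \<open>p\<close> is injective, and they have the same image
  \<open>g y\<close> under \<open>p\<close>, so they agree for all \<open>g\<close> in a neighbourhood of \<open>1\<close>
  and \<open>y\<close> in a neighbourhood \<open>B\<close> of \<open>x\<close>. The former contains an open normal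
  subgroup \<open>N\<close>, and \<open>s\<close> is then \<open>N\<close>-equivariant on \<open>V = N B\<close>.
\<close>

section \<open>Clopen neighbourhoods in profinite spaces\<close>

text \<open>In a compact Hausdorff space components and quasi-components coincide, so here
  \<open>{x}\<close> is a quasi-component. A quasi-component can be separated by a clopen set from
  any compact set disjoint from it, in particular from the complement of \<open>A\<close>.\<close>

lemma profinite_space_clopen_neighbourhood:
  assumes X: "profinite_space X" and A: "openin X A" "x \<in> A"
  obtains C where "openin X C" "closedin X C" "x \<in> C" "C \<subseteq> A"
proof -
  have x: "x \<in> topspace X"
    using A openin_subset by blast
  have compact: "compact_space X" and Hausdorff: "Hausdorff_space X"
    and disconnected: "totally_disconnected_space X"
    using X by (auto simp: profinite_space_def)
  obtain a where "connected_component_of_set X x \<subseteq> {a}"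
    using disconnected connectedin_connected_component_of [of X x]
    unfolding totally_disconnected_space_def by (elim allE impE exE) auto
  moreover have "x \<in> connected_component_of_set X x"
    using x by (simp add: connected_component_of_refl)
  ultimately have "connected_component_of_set X x = {x}"
    by blast
  then have "quasi_component_of_set X x = {x}"
    using quasi_eq_connected_component_of [of X x] compact Hausdorff by metis
  then have "{x} \<in> quasi_components_of X"
    using x unfolding quasi_components_of_def by (metis imageI)
  moreover have "compactin X (topspace X - A)"
    using A compact by (intro closedin_compact_space closedin_diff closedin_topspace)
  moreover have "disjnt {x} (topspace X - A)"
    using A by simp
  ultimately have "separated_between X {x} (topspace X - A)"
    by (simp only: separated_between_quasi_component_compact)
  then obtain C D where CD: "openin X C" "openin X D" "C \<union> D = topspace X" "disjnt C D"
      "{x} \<subseteq> C" "topspace X - A \<subseteq> D"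
    by (auto simp: separated_between_def)
  then have "C = topspace X - D"
    by (auto simp: disjnt_iff)
  then have "closedin X C"
    using CD(2) by blast
  moreover have "C \<subseteq> A"
    using CD by (auto simp: disjnt_iff)
  ultimately show ?thesis
    using that CD by blast
qed

section \<open>Open normal subgroups of profinite groups\<close>

lemma (in topological_group) continuous_map_group_mult:
  assumes "continuous_map Z T f" "continuous_map Z T g"
  shows "continuous_map Z T (\<lambda>z. f z \<otimes> g z)"
proof -
  have "continuous_map Z (prod_topology T T) (\<lambda>z. (f z, g z))"
    using assms by (simp add: continuous_map_pairedI)
  from continuous_map_compose [OF this continuous_mult]
  show ?thesis by (simp add: o_def)
qed

text \<open>The complement of \<open>N\<close> is the projection, along the compact space of pairs
  \<open>(a, b)\<close>, of the clopen set where \<open>a g b \<in> C\<close> and \<open>a b \<in> C\<close> disagree.\<close>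

lemma (in topological_group) clopen_contains_open_normal_subgroup:
  assumes compact: "compact_space T"
    and C: "openin T C" "closedin T C" "\<one> \<in> C"
  obtains N where "N \<lhd> G" "openin T N" "N \<subseteq> C"
proof -
  \<comment> \<open>This is the normal core of the stabiliser of \<open>C\<close> under right
    multiplication. Allowing factors on both sides builds conjugation invariance into the
    definition, and \<open>a = b = \<one>\<close> gives \<open>N \<subseteq> C\<close>.\<close>
  define N where "N = {g \<in> carrier G. \<forall>a\<in>carrier G. \<forall>b\<in>carrier G.
    (a \<otimes> g \<otimes> b \<in> C) = (a \<otimes> b \<in> C)}"
  have "subgroup N G"
  proof (rule subgroupI)
    show "N \<subseteq> carrier G" by (auto simp: N_def)
    show "N \<noteq> {}"
      using one_closed by (fastforce simp: N_def)
  next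
    fix g assume g: "g \<in> N"
    then have gG: "g \<in> carrier G" by (simp add: N_def)
    have "(a \<otimes> inv g \<otimes> b \<in> C) = (a \<otimes> b \<in> C)"
      if ab: "a \<in> carrier G" "b \<in> carrier G" for a b
    proof -
      \<comment> \<open>The condition on \<open>g\<close> is used with left factor
        \<open>a \<otimes> inv g\<close>, which cancels \<open>g\<close>.\<close>
      have "(a \<otimes> inv g \<otimes> g \<otimes> b \<in> C) = (a \<otimes> inv g \<otimes> b \<in> C)"
        using g gG ab by (simp add: N_def)
      then show ?thesis
        using gG ab by (simp add: m_assoc)
    qed
    then show "inv g \<in> N"
      using gG by (simp add: N_def)
  next
    fix g h assume gh: "g \<in> N" "h \<in> N"
    then have G: "g \<in> carrier G" "h \<in> carrier G" by (auto simp: N_def)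
    have "(a \<otimes> (g \<otimes> h) \<otimes> b \<in> C) = (a \<otimes> b \<in> C)"
      if ab: "a \<in> carrier G" "b \<in> carrier G" for a b
    proof -
      have "(a \<otimes> g \<otimes> h \<otimes> b \<in> C) = (a \<otimes> g \<otimes> b \<in> C)"
        using gh G ab by (simp add: N_def)
      also have "\<dots> = (a \<otimes> b \<in> C)"
        using gh ab by (simp add: N_def)
      finally show ?thesis
        using G ab by (simp add: m_assoc)
    qed
    then show "g \<otimes> h \<in> N"
      using G by (simp add: N_def)
  qed
  then have "N \<lhd> G"
  proof (rule normal_invI)
    fix x h assume x: "x \<in> carrier G" and h: "h \<in> N"
    then have hG: "h \<in> carrier G" by (simp add: N_def)
    have "(a \<otimes> (x \<otimes> h \<otimes> inv x) \<otimes> b \<in> C) = (a \<otimes> b \<in> C)"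
      if ab: "a \<in> carrier G" "b \<in> carrier G" for a b
    proof -
      \<comment> \<open>The conjugating elements are absorbed into the outer factors
        \<open>a\<close> and \<open>b\<close>.\<close>
      have "((a \<otimes> x) \<otimes> h \<otimes> (inv x \<otimes> b) \<in> C) = ((a \<otimes> x) \<otimes> (inv x \<otimes> b) \<in> C)"
        using h x ab by (simp add: N_def)
      moreover have "(a \<otimes> x) \<otimes> (inv x \<otimes> b) = a \<otimes> b"
        using x ab by (metis inv_closed inv_solve_left m_assoc m_closed)
      ultimately show ?thesis
        using x hG ab by (simp add: m_assoc)
    qed
    then show "x \<otimes> h \<otimes> inv x \<in> N"
      using x hG by (simp add: N_def)
  qed
  moreover have "openin T N"
  proof -
    let ?Z = "prod_topology (prod_topology T T) T"
    let ?l = "\<lambda>z. fst (fst z) \<otimes> snd z \<otimes> snd (fst z)"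
    let ?r = "\<lambda>z. fst (fst z) \<otimes> snd (fst z)"
    let ?D = "{z \<in> topspace ?Z. (?l z \<in> C) \<noteq> (?r z \<in> C)}"
    have fst_fst: "continuous_map ?Z T (\<lambda>z. fst (fst z))"
      and snd_fst: "continuous_map ?Z T (\<lambda>z. snd (fst z))"
      and snd: "continuous_map ?Z T snd"
      using continuous_map_compose [OF continuous_map_fst continuous_map_fst, of T T T]
        continuous_map_compose [OF continuous_map_fst continuous_map_snd, of T T T]
      by (simp_all add: o_def continuous_map_snd)
    have l: "continuous_map ?Z T ?l" and r: "continuous_map ?Z T ?r"
      by (intro continuous_map_group_mult fst_fst snd_fst snd)+
    note pre = openin_continuous_map_preimage [OF l C(1)] closedin_continuous_map_preimage [OF l C(2)]
      openin_continuous_map_preimage [OF r C(1)] closedin_continuous_map_preimage [OF r C(2)]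
    \<comment> \<open>The symmetric difference is a union of closed preimages minus an intersection
      of open ones; \<open>C\<close> serves both as a closed and as an open set.\<close>
    have "closedin ?Z (({z \<in> topspace ?Z. ?l z \<in> C} \<union> {z \<in> topspace ?Z. ?r z \<in> C})
        - ({z \<in> topspace ?Z. ?l z \<in> C} \<inter> {z \<in> topspace ?Z. ?r z \<in> C}))"
      by (intro closedin_diff closedin_Un openin_Int pre)
    moreover have "?D = ({z \<in> topspace ?Z. ?l z \<in> C} \<union> {z \<in> topspace ?Z. ?r z \<in> C})
        - ({z \<in> topspace ?Z. ?l z \<in> C} \<inter> {z \<in> topspace ?Z. ?r z \<in> C})"
      by blast
    ultimately have "closedin ?Z ?D"
      by (simp only:)
    \<comment> \<open>Projecting away a compact factor is a closed map, and the space of pairs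
      \<open>(a, b)\<close> inherits compactness from \<open>T\<close>.\<close>
    moreover have "closed_map ?Z T snd"
      using compact by (simp add: closed_map_snd compact_space_prod_topology)
    ultimately have "closedin T (snd ` ?D)"
      by (simp add: closed_map_def)
    moreover have "N = topspace T - snd ` ?D"
    proof (intro equalityI subsetI)
      fix g assume g: "g \<in> N"
      have "g \<noteq> snd z" if "z \<in> ?D" for z
        using g that by (auto simp: N_def topspace_eq_carrier)
      then show "g \<in> topspace T - snd ` ?D"
        using g by (simp add: N_def topspace_eq_carrier image_iff)
    next
      fix g assume g: "g \<in> topspace T - snd ` ?D"
      have "(a \<otimes> g \<otimes> b \<in> C) = (a \<otimes> b \<in> C)" if "a \<in> carrier G" "b \<in> carrier G" for a b
      proof -
        have "((a, b), g) \<notin> ?D"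
        proof
          assume "((a, b), g) \<in> ?D"
          from imageI [OF this, of snd] have "g \<in> snd ` ?D"
            by (simp only: snd_conv)
          with g show False
            by (rule DiffD2)
        qed
        then show ?thesis
          using g that by (simp add: topspace_eq_carrier)
      qed
      then show "g \<in> N"
        using g by (simp add: N_def topspace_eq_carrier)
    qed
    ultimately show ?thesis
      by (simp only: openin_diff openin_topspace)
  qed
  moreover have "N \<subseteq> C"
  proof
    fix g assume "g \<in> N"
    then have "g \<in> carrier G" "(\<one> \<otimes> g \<otimes> \<one> \<in> C) = (\<one> \<otimes> \<one> \<in> C)"
      using one_closed unfolding N_def by blast+
    then show "g \<in> C"
      using C(3) by simp
  qed
  ultimately show ?thesis
    using that by blast
qed

text \<open>The neighbourhood is first shrunk to a clopen one, since the construction of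
  \<open>N\<close> starts from a clopen set.\<close>

lemma (in profinite_group) open_normal_subgroup_basis:
  assumes "openin T A" "\<one> \<in> A"
  obtains N where "N \<lhd> G" "openin T N" "N \<subseteq> A"
proof -
  obtain C where C: "openin T C" "closedin T C" "\<one> \<in> C" "C \<subseteq> A"
    using profinite_space_clopen_neighbourhood [OF profinite assms] .
  have "compact_space T"
    using profinite by (simp add: profinite_space_def)
  then obtain N where "N \<lhd> G" "openin T N" "N \<subseteq> C"
    using clopen_contains_open_normal_subgroup C by blast
  with C that show ?thesis by blast
qed

section \<open>Continuous group actions\<close>

lemma (in group_action) one_act:
  "x \<in> E \<Longrightarrow> \<phi> \<one> x = x"
  by (metis id_eq_one restrict_apply')

lemma (in group_action) act_inv_act:
  assumes "g \<in> carrier G" "x \<in> E"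
  shows "\<phi> g (\<phi> (inv g) x) = x" "\<phi> (inv g) (\<phi> g x) = x"
proof -
  interpret group G
    using group_hom by (simp add: group_hom_def)
  show "\<phi> g (\<phi> (inv g) x) = x" "\<phi> (inv g) (\<phi> g x) = x"
    using assms one_act by (simp_all flip: composition_rule)
qed

lemma (in G_space) continuous_map_act:
  assumes "continuous_map Z T f" "continuous_map Z X h"
  shows "continuous_map Z X (\<lambda>z. \<phi> (f z) (h z))"
proof -
  have "continuous_map Z (prod_topology T X) (\<lambda>z. (f z, h z))"
    using assms by (simp add: continuous_map_pairedI)
  from continuous_map_compose [OF this continuous_action]
  show ?thesis by (simp add: o_def)
qed

text \<open>The image under \<open>\<phi> g\<close> is the preimage under the continuous map
  \<open>\<phi> (inv g)\<close>.\<close>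

lemma (in G_space) openin_act_image:
  assumes g: "g \<in> carrier G" and B: "openin X B"
  shows "openin X (\<phi> g ` B)"
proof -
  have "continuous_map X X (\<phi> (inv g))"
    using continuous_map_act [of X "\<lambda>_. inv g" "\<lambda>x. x"] g
    by (simp add: topspace_eq_carrier)
  then have "openin X {x \<in> topspace X. \<phi> (inv g) x \<in> B}"
    using B by (rule openin_continuous_map_preimage)
  moreover have "{x \<in> topspace X. \<phi> (inv g) x \<in> B} = \<phi> g ` B"
  proof (intro equalityI subsetI)
    fix x assume "x \<in> {x \<in> topspace X. \<phi> (inv g) x \<in> B}"
    then show "x \<in> \<phi> g ` B"
      using act_inv_act(1) [OF g] by (metis (mono_tags, lifting) imageI mem_Collect_eq)
  next
    fix x assume "x \<in> \<phi> g ` B"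
    then show "x \<in> {x \<in> topspace X. \<phi> (inv g) x \<in> B}"
      using act_inv_act(2) [OF g] openin_subset [OF B] element_image [OF g] by auto
  qed
  ultimately show ?thesis by simp
qed

section \<open>Equivariance of sections near a point\<close>

lemma (in equivariant_sheaf) section_locally_equivariant:
  assumes U: "openin X U" and s: "s \<in> sections E X p U" and x: "x \<in> U"
  obtains A B where "openin T A" "\<one> \<in> A" "openin X B" "x \<in> B" "B \<subseteq> U"
    "\<And>g y. g \<in> A \<Longrightarrow> y \<in> B \<Longrightarrow> \<phi> g y \<in> U \<and> s (\<phi> g y) = \<psi> g (s y)"
proof -
  have cont: "continuous_map (subtopology X U) E s" and sec: "\<And>y. y \<in> U \<Longrightarrow> p (s y) = y"
    using s by (auto simp: sections_def)
  have UX: "U \<subseteq> topspace X"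
    using U by (rule openin_subset)
  then have sE: "s y \<in> topspace E" if "y \<in> U" for y
    using cont that by (auto simp: continuous_map_def Pi_iff)
  then obtain W where W: "openin E W" "s x \<in> W"
      "homeomorphic_map (subtopology E W) (subtopology X (p ` W)) p"
    using local_homeo x unfolding local_homeomorphism_def by blast
  have "topspace (subtopology E W) = W"
    using openin_subset [OF W(1)] by auto
  then have inj: "inj_on p W"
    using homeomorphic_imp_injective_map [OF W(3)] by simp
  let ?U = "subtopology X U"
  let ?Z = "prod_topology T ?U"
  let ?O = "{y \<in> U. s y \<in> W}"
  \<comment> \<open>These are the pairs \<open>(g, y)\<close> for which both
    \<open>\<psi> g (s y)\<close> and \<open>s (\<phi> g y)\<close> lie in \<open>W\<close>.
    Membership in \<open>?O\<close> also keeps \<open>\<phi> g y\<close> inside \<open>U\<close>,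
    where \<open>s\<close> is a section.\<close>
  let ?P = "{z \<in> topspace ?Z. \<psi> (fst z) (s (snd z)) \<in> W} \<inter>
    {z \<in> topspace ?Z. \<phi> (fst z) (snd z) \<in> ?O}"
  have topspace_U: "topspace ?U = U"
    using UX by auto
  have snd: "continuous_map ?Z ?U snd"
    by (rule continuous_map_snd)
  have "openin ?U {y \<in> topspace ?U. s y \<in> W}"
    using cont W(1) by (rule openin_continuous_map_preimage)
  then have O: "openin X ?O"
    using U unfolding topspace_U by (rule openin_trans_full)
  have "continuous_map ?Z E (\<lambda>z. \<psi> (fst z) (s (snd z)))"
    using total.continuous_map_act [OF continuous_map_fst]
      continuous_map_compose [OF snd cont] by (simp add: o_def)
  moreover have "continuous_map ?Z X (\<lambda>z. \<phi> (fst z) (snd z))"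
    by (intro base.continuous_map_act continuous_map_fst continuous_map_into_fulltopology [OF snd])
  ultimately have "openin ?Z ?P"
    using W(1) O by (intro openin_Int openin_continuous_map_preimage)
  moreover have "(\<one>, x) \<in> ?P"
    using x UX W(2) sE base.one_act total.one_act
    by (auto simp: base.topspace_eq_carrier)
  ultimately obtain A B where AB: "openin T A" "openin ?U B" "\<one> \<in> A" "x \<in> B" "A \<times> B \<subseteq> ?P"
    unfolding openin_prod_topology_alt by meson
  have B: "openin X B" "B \<subseteq> U"
    using AB(2) U openin_trans_full openin_subset topspace_U by blast+
  have "\<phi> g y \<in> U \<and> s (\<phi> g y) = \<psi> g (s y)" if gy: "g \<in> A" "y \<in> B" for g y
  proof -
    have "(g, y) \<in> ?P"
      using AB(5) gy by blast
    then have W: "\<psi> g (s y) \<in> W" "s (\<phi> g y) \<in> W" "\<phi> g y \<in> U"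
      by auto
    have "g \<in> carrier G"
      using gy AB(1) openin_subset base.topspace_eq_carrier by blast
    then have "p (\<psi> g (s y)) = \<phi> g y"
      using equivariant sE sec B(2) gy by (metis subsetD)
    then have "p (s (\<phi> g y)) = p (\<psi> g (s y))"
      using W(3) sec by simp
    then show ?thesis
      using inj W by (auto dest: inj_onD)
  qed
  then show ?thesis
    using that AB B by blast
qed

lemma restrict_section:
  assumes "s \<in> sections E X p U" "V \<subseteq> U"
  shows "restrict s V \<in> sections E X p V"
proof -
  have "continuous_map (subtopology X V) E s"
    using assms continuous_map_from_subtopology_mono by (fastforce simp: sections_def)
  then have "continuous_map (subtopology X V) E (restrict s V)"
    by (rule continuous_map_eq) simp
  then show ?thesis
    using assms by (auto simp: sections_def)
qed

text \<open>The set \<open>B\<close> need not be invariant, so it is replaced by its saturation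
  \<open>V\<close> under \<open>N\<close>. This stays inside \<open>U\<close> because
  \<open>N \<subseteq> A\<close>, and the agreement known on \<open>B\<close> spreads to
  \<open>V\<close> because \<open>N\<close> is closed under products.\<close>

lemma (in equivariant_sheaf) section_equivariant_near_point:
  assumes profinite: "profinite_group G T"
    and U: "openin X U" and s: "s \<in> sections E X p U" and x: "x \<in> U"
  obtains N V where "N \<lhd> G" "openin T N" "openin X V" "x \<in> V" "V \<subseteq> U"
    "invariant_set \<phi> N V" "equivariant_section G \<phi> \<psi> N V (restrict s V)"
proof -
  obtain A B where AB: "openin T A" "\<one> \<in> A" "openin X B" "x \<in> B" "B \<subseteq> U"
    and local: "\<And>g y. g \<in> A \<Longrightarrow> y \<in> B \<Longrightarrow> \<phi> g y \<in> U \<and> s (\<phi> g y) = \<psi> g (s y)"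
    using section_locally_equivariant [OF U s x] by metis
  obtain N where N: "N \<lhd> G" "openin T N" "N \<subseteq> A"
    using profinite_group.open_normal_subgroup_basis [OF profinite AB(1,2)] .
  interpret N: normal N G by (rule N(1))
  define V where "V = (\<Union>n\<in>N. \<phi> n ` B)"
  have BX: "B \<subseteq> topspace X"
    using AB(3) by (rule openin_subset)
  have UX: "U \<subseteq> topspace X"
    using U by (rule openin_subset)
  have sE: "s y \<in> topspace E" if "y \<in> U" for y
    using s that UX by (auto simp: sections_def continuous_map_def Pi_iff)
  have "openin X V"
    unfolding V_def using base.openin_act_image AB(3) N.subset by blast
  moreover have "x \<in> V"
  proof -
    have "x = \<phi> \<one> x"
      using base.one_act AB(4) BX by auto
    then show ?thesis
      unfolding V_def using N.one_closed AB(4) by blast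
  qed
  moreover have VU: "V \<subseteq> U"
    unfolding V_def using local N(3) by blast
  moreover have act: "\<phi> n v \<in> V \<and> s (\<phi> n v) = \<psi> n (s v)" if n: "n \<in> N" and v: "v \<in> V" for n v
  proof -
    obtain m b where mb: "m \<in> N" "b \<in> B" "v = \<phi> m b"
      using v unfolding V_def by blast
    have nG: "n \<in> carrier G" and mG: "m \<in> carrier G"
      using n mb(1) N.subset by auto
    have eq: "\<phi> n v = \<phi> (n \<otimes> m) b"
      using nG mG mb BX base.composition_rule by auto
    have nm: "n \<otimes> m \<in> N"
      using n mb(1) by simp
    \<comment> \<open>Both \<open>n \<otimes> m\<close> and \<open>m\<close> lie in
      \<open>A\<close>, so the local agreement applies twice at the same point \<open>b\<close>, and
      the two results are compared.\<close>
    have "s (\<phi> (n \<otimes> m) b) = \<psi> (n \<otimes> m) (s b)"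
      using local nm mb(2) N(3) by blast
    also have "\<dots> = \<psi> n (\<psi> m (s b))"
      using nG mG sE mb(2) AB(5) total.composition_rule by blast
    also have "\<dots> = \<psi> n (s v)"
      using local mb N(3) by (metis subsetD)
    finally show ?thesis
      using eq nm mb(2) unfolding V_def by auto
  qed
  \<comment> \<open>Stability under inverses upgrades the inclusion of the translate of
    \<open>V\<close> in \<open>V\<close> to an equality, and it keeps the argument of the translated
    section inside \<open>V\<close>.\<close>
  moreover have inv_V: "\<phi> (inv n) v \<in> V" "\<phi> n (\<phi> (inv n) v) = v" if "n \<in> N" "v \<in> V" for n v
  proof -
    show "\<phi> (inv n) v \<in> V"
      using act [of "inv n" v] N.m_inv_closed that by simp
    have "n \<in> carrier G" "v \<in> topspace X"
      using that N.subset VU UX by auto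
    then show "\<phi> n (\<phi> (inv n) v) = v"
      by (rule base.act_inv_act)
  qed
  moreover have image: "\<phi> n ` V = V" if n: "n \<in> N" for n
  proof (intro equalityI subsetI)
    fix v assume "v \<in> V"
    then show "v \<in> \<phi> n ` V"
      using inv_V [OF n] by (metis imageI)
  qed (use act n in blast)
  moreover have "translate_section G \<phi> \<psi> n V (restrict s V) = restrict s V" if n: "n \<in> N" for n
    unfolding translate_section_def image [OF n]
  proof (rule restrict_ext)
    fix v assume "v \<in> V"
    \<comment> \<open>This is \<open>act\<close> at the point \<open>\<phi> (inv n) v\<close>, which
      \<open>n\<close> carries back to \<open>v\<close>.\<close>
    then show "\<psi> n (restrict s V (\<phi> (inv n) v)) = s v"
      using inv_V [OF n] act [OF n] by (metis restrict_apply')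
  qed
  ultimately show ?thesis
    using that [of N V] N by (simp add: invariant_set_def equivariant_section_def)
qed

text \<open>Asking for a domain around each point of \<open>U\<close> excludes the trivial choice of
  an empty \<open>V\<close>: the invariant domains cover \<open>U\<close>. Both \<open>N\<close> and
  \<open>V\<close> may depend on the point.\<close>

theorem proposition3p1:
  fixes G :: "('g, 'm) monoid_scheme" and T :: "'g topology"
    and X :: "'x topology" and \<phi> :: "'g \<Rightarrow> 'x \<Rightarrow> 'x"
    and E :: "'e topology" and \<psi> :: "'g \<Rightarrow> 'e \<Rightarrow> 'e" and p :: "'e \<Rightarrow> 'x"
    and U :: "'x set" and s :: "'x \<Rightarrow> 'e"
  assumes "profinite_group G T"
    and "profinite_G_space G T X \<phi>"
    and "equivariant_sheaf G T X \<phi> E \<psi> p"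
    and "openin X U"
    and "s \<in> sections E X p U"
  shows "\<forall>x\<in>U. \<exists>N V. N \<lhd> G \<and> openin T N \<and>
           openin X V \<and> x \<in> V \<and> V \<subseteq> U \<and> invariant_set \<phi> N V \<and>
           restrict s V \<in> sections E X p V \<and>
           equivariant_section G \<phi> \<psi> N V (restrict s V)"
proof
  fix x assume x: "x \<in> U"
  obtain N V where "N \<lhd> G" "openin T N" "openin X V" "x \<in> V" "V \<subseteq> U"
    "invariant_set \<phi> N V" "equivariant_section G \<phi> \<psi> N V (restrict s V)"
    using equivariant_sheaf.section_equivariant_near_point [OF assms(3,1,4,5) x] by blast
  then show "\<exists>N V. N \<lhd> G \<and> openin T N \<and>
           openin X V \<and> x \<in> V \<and> V \<subseteq> U \<and> invariant_set \<phi> N V \<and>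
           restrict s V \<in> sections E X p V \<and>
           equivariant_section G \<phi> \<psi> N V (restrict s V)"
    using restrict_section [OF assms(5)] by blast
qed

end
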